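(* Let $\mu^{\rm b},\mu^{\rm a}$ be probability measures on $\mathbb{R}_+$ with finite first moment such that $\mu^{\rm b}\preceq_{\rm cx}\mu^{\rm a}$. For every upper semicontinuous function $h:\mathbb{R}_+\to\mathbb{R}$ with linear growth, $$\sup_{\mu\in\mathcal{Q}(\mu^{\rm b},\mu^{\rm a})}\mu(h)=\inf_{(\psi^{\rm a},\psi^{\rm b})\in\Psi^{\rm b,a}(h)}\big(\mu^{\rm a}(\psi^{\rm a})-\mu^{\rm b}(\psi^{\rm b})\big).$$ Moreover, there exists $\mu^\star\in\mathcal{Q}(\mu^{\rm b},\mu^{\rm a})$ attaining the supremum on the left-hand side.
   Context: $\mathbb{R}_+=[0,\infty)$; $\mathcal{P}_1$ is the set of probability measures on $\mathbb{R}_+$ with finite first moment; $\mu(f)=\int f\,d\mu$. A function $f:\mathbb{R}_+\to\mathbb{R}$ has linear growth if $\sup_x|f(x)|/(1+|x|)<\infty$. $\mathrm{CVX}_L$ is the set of continuous convex functions $\psi:\mathbb{R}_+\to\mathbb{R}$ with linear growth. For $\mu,\nu\in\mathcal{P}_1$, $\mu\preceq_{\rm cx}\nu$ means $\mu(\psi)\le\nu(\psi)$ for all $\psi\in\mathrm{CVX}_L$. Set $$\mathcal{Q}(\mu^{\rm b},\mu^{\rm a})=\{\mu\in\mathcal{P}_1:\mu^{\rm b}\preceq_{\rm cx}\mu\preceq_{\rm cx}\mu^{\rm a}\},\qquad \Psi^{\rm b,a}(h)=\{(\psi^{\rm a},\psi^{\rm b})\in\mathrm{CVX}_L^2:\psi^{\rm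 a}-\psi^{\rm b}\ge h\text{ on }\mathbb{R}_+\}.$$ *)

theory Defs
  imports "HOL-Probability.Probability"
begin

text \<open>
  The half-line is the set \<open>{0..}\<close> of reals. Functions on it are represented by functions of type
  \<open>real \<Rightarrow> real\<close>, whose values at negative arguments are never constrained: measures on the
  half-line are measures with underlying space \<open>{0..}\<close>, so integrals only see the values there.
\<close>

definition borel_Rplus :: "real measure" where
  "borel_Rplus = restrict_space borel {0..}"

definition P1 :: "real measure set" where
  "P1 = {\<mu>. prob_space \<mu> \<and> sets \<mu> = sets borel_Rplus \<and> integrable \<mu> (\<lambda>x. x)}"

definition linear_growth :: "(real \<Rightarrow> real) \<Rightarrow> bool" where
  "linear_growth f \<longleftrightarrow> bdd_above ((\<lambda>x. \<bar>f x\<bar> / (1 + \<bar>x\<bar>)) ` {0..})"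

definition usc_on :: "'a::topological_space set \<Rightarrow> ('a \<Rightarrow> real) \<Rightarrow> bool" where
  "usc_on S f \<longleftrightarrow> (\<forall>x\<in>S. \<forall>c>f x. \<forall>\<^sub>F y in at x within S. f y < c)"

definition CVX_L :: "(real \<Rightarrow> real) set" where
  "CVX_L = {\<psi>. continuous_on {0..} \<psi> \<and> convex_on {0..} \<psi> \<and> linear_growth \<psi>}"

definition cx_le :: "real measure \<Rightarrow> real measure \<Rightarrow> bool" (infix "\<preceq>\<^sub>c\<^sub>x" 50) where
  "\<mu> \<preceq>\<^sub>c\<^sub>x \<nu> \<longleftrightarrow> (\<forall>\<psi>\<in>CVX_L. (LINT x|\<mu>. \<psi> x) \<le> (LINT x|\<nu>. \<psi> x))"

definition Q :: "real measure \<Rightarrow> real measure \<Rightarrow> real measure set" where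
  "Q \<mu>b \<mu>a = {\<mu> \<in> P1. \<mu>b \<preceq>\<^sub>c\<^sub>x \<mu> \<and> \<mu> \<preceq>\<^sub>c\<^sub>x \<mu>a}"

definition Psi :: "(real \<Rightarrow> real) \<Rightarrow> ((real \<Rightarrow> real) \<times> (real \<Rightarrow> real)) set" where
  "Psi h = {(\<psi>a, \<psi>b). \<psi>a \<in> CVX_L \<and> \<psi>b \<in> CVX_L \<and> (\<forall>x\<in>{0..}. \<psi>a x - \<psi>b x \<ge> h x)}"

end

theory Submission
  imports Defs
begin

text \<open>
  The value of the dual problem is a sublinear functional on the functions of linear growth. By
  Hahn-Banach it dominates a linear functional \<open>L\<close> which agrees with it at \<open>h\<close>. Such an \<open>L\<close> is
  positive, normalized, and lies between \<open>\<mu>b\<close> and \<open>\<mu>a\<close> on convex functions; in particular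
  \<open>L (x - n)\<^sup>+\<close> tends to \<open>0\<close>, so that on continuous functions \<open>L\<close> is integration against a measure
  \<open>\<mu> \<in> Q \<mu>b \<mu>a\<close>. As \<open>L\<close> is only finitely additive, \<open>L h\<close> need not be \<open>\<mu>(h)\<close>, but \<open>h\<close> is a decreasing
  limit of continuous functions, whence \<open>L h \<le> \<mu>(h)\<close>. Together with weak duality \<open>\<mu>\<close> is a maximizer
  and there is no duality gap.
\<close>

subsection \<open>Hahn-Banach on spaces of real functions\<close>

text \<open>The operations are pointwise. Scaling by \<open>0\<close> puts the zero function into
  every nonempty \<open>V\<close>.\<close>

definition fun_subspace :: "('a \<Rightarrow> real) set \<Rightarrow> bool" where
  "fun_subspace V \<longleftrightarrow>
     (\<forall>f\<in>V. \<forall>g\<in>V. (\<lambda>x. f x + g x) \<in> V) \<and> (\<forall>f\<in>V. \<forall>c. (\<lambda>x. c * f x) \<in> V)"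

text \<open>Scaling is required in one direction; applied to \<open>inverse c\<close> it returns the
  other one. For an infimum of such functionals a single inequality is then to be checked.\<close>

definition sublinear_on :: "('a \<Rightarrow> real) set \<Rightarrow> (('a \<Rightarrow> real) \<Rightarrow> real) \<Rightarrow> bool" where
  "sublinear_on V q \<longleftrightarrow>
     (\<forall>f\<in>V. \<forall>g\<in>V. q (\<lambda>x. f x + g x) \<le> q f + q g) \<and> (\<forall>f\<in>V. \<forall>c>0. q (\<lambda>x. c * f x) \<le> c * q f)"

definition linear_on_funs :: "('a \<Rightarrow> real) set \<Rightarrow> (('a \<Rightarrow> real) \<Rightarrow> real) \<Rightarrow> bool" where
  "linear_on_funs V L \<longleftrightarrow>
     (\<forall>f\<in>V. \<forall>g\<in>V. L (\<lambda>x. f x + g x) = L f + L g) \<and> (\<forall>f\<in>V. \<forall>c. L (\<lambda>x. c * f x) = c * L f)"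

lemma fun_subspace_add: "fun_subspace V \<Longrightarrow> f \<in> V \<Longrightarrow> g \<in> V \<Longrightarrow> (\<lambda>x. f x + g x) \<in> V"
  and fun_subspace_scale: "fun_subspace V \<Longrightarrow> f \<in> V \<Longrightarrow> (\<lambda>x. c * f x) \<in> V"
  by (auto simp: fun_subspace_def)

lemma fun_subspace_uminus: "fun_subspace V \<Longrightarrow> f \<in> V \<Longrightarrow> (\<lambda>x. - f x) \<in> V"
  using fun_subspace_scale[of V f "-1"] by simp

lemma sublinear_on_add:
    "sublinear_on V q \<Longrightarrow> f \<in> V \<Longrightarrow> g \<in> V \<Longrightarrow> q (\<lambda>x. f x + g x) \<le> q f + q g"
  and sublinear_on_scale_le: "sublinear_on V q \<Longrightarrow> f \<in> V \<Longrightarrow> c > 0 \<Longrightarrow> q (\<lambda>x. c * f x) \<le> c * q f"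
  by (auto simp: sublinear_on_def)

lemma sublinear_on_scale:
  assumes V: "fun_subspace V" and q: "sublinear_on V q" and f: "f \<in> V" and c: "c > 0"
  shows "q (\<lambda>x. c * f x) = c * q f"
proof (rule antisym)
  have "q (\<lambda>x. inverse c * (c * f x)) \<le> inverse c * q (\<lambda>x. c * f x)"
    by (rule sublinear_on_scale_le[OF q fun_subspace_scale[OF V f]]) (use c in simp)
  then show "c * q f \<le> q (\<lambda>x. c * f x)"
    using c by (simp add: field_simps)
qed (rule sublinear_on_scale_le[OF q f c])

lemma sublinear_on_zero:
  assumes V: "fun_subspace V" and q: "sublinear_on V q" and f: "f \<in> V"
  shows "q (\<lambda>x. 0) = 0"
  using sublinear_on_scale[OF V q fun_subspace_scale[OF V f, of 0], of 2] by simp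

lemma sublinear_on_uminus_ge:
  assumes V: "fun_subspace V" and q: "sublinear_on V q" and f: "f \<in> V"
  shows "- q (\<lambda>x. - f x) \<le> q f"
  using sublinear_on_add[OF q f fun_subspace_uminus[OF V f]] sublinear_on_zero[OF V q f] by simp

text \<open>The functional \<open>q\<close> is pinned at \<open>v\<close>:
  \<open>q v \<le> p v\<close> and \<open>q (- v) \<le> - p v\<close> leave only the value
  \<open>p v\<close> for any linear functional below \<open>q\<close>. The infimum of
  \<open>p (f + t v) - t p v\<close> over \<open>t \<ge> 0\<close> is the largest sublinear
  functional below \<open>p\<close> with this property.\<close>

lemma sublinear_on_reduce:
  assumes V: "fun_subspace V" and p: "sublinear_on V p" and v: "v \<in> V"
  obtains q where "sublinear_on V q" "\<And>f. f \<in> V \<Longrightarrow> q f \<le> p f" "q (\<lambda>x. - v x) \<le> - p v"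
proof -
  define r where "r f t = p (\<lambda>x. f x + t * v x) - t * p v" for f t
  define q where "q f = (INF t\<in>{0..}. r f t)" for f
  have r0: "r f 0 = p f" for f
    by (simp add: r_def)
  \<comment> \<open>Subadditivity for \<open>t v = (f + t v) + (- f)\<close> bounds
    \<open>r f t\<close> below independently of \<open>t\<close>, so the infimum is a genuine
    one.\<close>
  have lower: "- p (\<lambda>x. - f x) \<le> r f t" if f: "f \<in> V" and t: "t \<ge> 0" for f t
  proof (cases "t = 0")
    case True
    then show ?thesis using sublinear_on_uminus_ge[OF V p f] by (simp add: r0)
  next
    case False
    have "p (\<lambda>x. (f x + t * v x) + - f x) \<le> p (\<lambda>x. f x + t * v x) + p (\<lambda>x. - f x)"
      using f v by (intro sublinear_on_add[OF p] fun_subspace_add[OF V] fun_subspace_scale[OF V]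
          fun_subspace_uminus[OF V])
    moreover have "p (\<lambda>x. (f x + t * v x) + - f x) = t * p v"
      using sublinear_on_scale[OF V p v, of t] False t by simp
    ultimately show ?thesis by (simp add: r_def)
  qed
  then have bdd: "bdd_below (r f ` {0..})" if "f \<in> V" for f
    using that by (intro bdd_belowI2[where m = "- p (\<lambda>x. - f x)"]) auto
  have q_le: "q f \<le> r f t" if "f \<in> V" "t \<ge> 0" for f t
    unfolding q_def using that bdd by (auto intro: cINF_lower)
  have q_ge: "m \<le> q f" if "\<And>t. t \<ge> 0 \<Longrightarrow> m \<le> r f t" for m f
    unfolding q_def using that by (auto intro!: cINF_greatest)
  show thesis
  proof
    show "q f \<le> p f" if "f \<in> V" for f
      using q_le[OF that, of 0] by (simp add: r0)
    \<comment> \<open>At \<open>t = 1\<close> the argument of \<open>p\<close> cancels to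
      \<open>0\<close>, leaving \<open>- p v\<close>.\<close>
    have "q (\<lambda>x. - v x) \<le> r (\<lambda>x. - v x) 1"
      using v by (intro q_le fun_subspace_uminus[OF V]) auto
    then show "q (\<lambda>x. - v x) \<le> - p v"
      using sublinear_on_zero[OF V p v] by (simp add: r_def)
    show "sublinear_on V q"
      unfolding sublinear_on_def
    proof (intro conjI ballI allI impI)
      fix f g assume f: "f \<in> V" and g: "g \<in> V"
      have fg: "(\<lambda>x. f x + g x) \<in> V"
        by (rule fun_subspace_add[OF V f g])
      \<comment> \<open>The parameters \<open>t\<close> for \<open>f\<close> and \<open>s\<close>
        for \<open>g\<close> combine to \<open>t + s\<close> for the sum; the two infima are then
        taken one after the other.\<close>
      have key: "q (\<lambda>x. f x + g x) \<le> r f t + r g s" if "t \<ge> 0" "s \<ge> 0" for t s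
      proof -
        have "q (\<lambda>x. f x + g x) \<le> r (\<lambda>x. f x + g x) (t + s)"
          using that by (intro q_le fg) auto
        also have "\<dots> = p (\<lambda>x. (f x + t * v x) + (g x + s * v x)) - (t + s) * p v"
          by (simp add: r_def algebra_simps)
        also have "\<dots> \<le> r f t + r g s"
          using sublinear_on_add[OF p, of "\<lambda>x. f x + t * v x" "\<lambda>x. g x + s * v x"]
            fun_subspace_add[OF V f fun_subspace_scale[OF V v]]
            fun_subspace_add[OF V g fun_subspace_scale[OF V v]]
          by (simp add: r_def algebra_simps)
        finally show ?thesis .
      qed
      have "q (\<lambda>x. f x + g x) - r f t \<le> q g" if "t \<ge> 0" for t
        by (rule q_ge) (use key[OF that] in \<open>simp add: algebra_simps\<close>)
      then have "q (\<lambda>x. f x + g x) - q g \<le> q f"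
        by (intro q_ge) (simp add: algebra_simps)
      then show "q (\<lambda>x. f x + g x) \<le> q f + q g" by simp
    next
      fix f and c :: real assume f: "f \<in> V" and c: "0 < c"
      have "q (\<lambda>x. c * f x) / c \<le> r f t" if t: "t \<ge> 0" for t
      proof -
        \<comment> \<open>The parameter \<open>c * t\<close> for \<open>c f\<close> lets
          \<open>c\<close> factor out of both terms.\<close>
        have "q (\<lambda>x. c * f x) \<le> r (\<lambda>x. c * f x) (c * t)"
          using c t by (intro q_le fun_subspace_scale[OF V f]) auto
        also have "\<dots> = p (\<lambda>x. c * (f x + t * v x)) - c * t * p v"
          by (simp add: r_def algebra_simps)
        also have "\<dots> = c * r f t"
          using sublinear_on_scale[OF V p fun_subspace_add[OF V f fun_subspace_scale[OF V v]] c, of t]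
          by (simp add: r_def algebra_simps)
        finally show ?thesis using c by (simp add: field_simps)
      qed
      then have "q (\<lambda>x. c * f x) / c \<le> q f" by (rule q_ge)
      then show "q (\<lambda>x. c * f x) \<le> c * q f" using c by (simp add: field_simps)
    qed
  qed
qed

text \<open>The pointwise infimum of the chain works. It is finite because every member lies above
  \<open>- p (- f)\<close>, and subadditive because two members can always be replaced by the
  smaller one.\<close>

lemma sublinear_on_chain_bound:
  assumes V: "fun_subspace V" and p: "sublinear_on V p" and ne: "C \<noteq> {}"
    and C: "\<And>q. q \<in> C \<Longrightarrow> sublinear_on V q" "\<And>q f. q \<in> C \<Longrightarrow> f \<in> V \<Longrightarrow> q f \<le> p f"
    and chain: "\<And>q r. q \<in> C \<Longrightarrow> r \<in> C \<Longrightarrow> (\<forall>f\<in>V. q f \<le> r f) \<or> (\<forall>f\<in>V. r f \<le> q f)"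
  obtains u where "sublinear_on V u" "\<And>q f. q \<in> C \<Longrightarrow> f \<in> V \<Longrightarrow> u f \<le> q f"
proof
  define u where "u f = (INF q\<in>C. q f)" for f
  have "- p (\<lambda>x. - f x) \<le> q f" if "q \<in> C" "f \<in> V" for q f
    using sublinear_on_uminus_ge[OF V C(1)[OF that(1)] that(2)]
      C(2)[OF that(1) fun_subspace_uminus[OF V that(2)]] by linarith
  then have bdd: "bdd_below ((\<lambda>q. q f) ` C)" if "f \<in> V" for f
    using that by (intro bdd_belowI2[where m = "- p (\<lambda>x. - f x)"]) auto
  show u_le: "u f \<le> q f" if "q \<in> C" "f \<in> V" for q f
    unfolding u_def using that bdd by (auto intro: cINF_lower)
  have u_ge: "m \<le> u f" if "\<And>q. q \<in> C \<Longrightarrow> m \<le> q f" for m f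
    unfolding u_def using that ne by (auto intro!: cINF_greatest)
  show "sublinear_on V u"
    unfolding sublinear_on_def
  proof (intro conjI ballI allI impI)
    fix f g assume f: "f \<in> V" and g: "g \<in> V"
    have fg: "(\<lambda>x. f x + g x) \<in> V"
      by (rule fun_subspace_add[OF V f g])
    \<comment> \<open>If \<open>q \<le> r\<close> on \<open>V\<close>, then
      \<open>q (f + g) \<le> q f + q g \<le> q f + r g\<close>; the other case is symmetric.\<close>
    have key: "u (\<lambda>x. f x + g x) \<le> q f + r g" if qr: "q \<in> C" "r \<in> C" for q r
      using chain[OF qr] u_le[OF qr(1) fg] u_le[OF qr(2) fg]
        sublinear_on_add[OF C(1)[OF qr(1)] f g] sublinear_on_add[OF C(1)[OF qr(2)] f g] f g
      by fastforce
    have "u (\<lambda>x. f x + g x) - q f \<le> u g" if "q \<in> C" for q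
      by (rule u_ge) (use key[OF that] in \<open>simp add: algebra_simps\<close>)
    then have "u (\<lambda>x. f x + g x) - u g \<le> u f"
      by (intro u_ge) (simp add: algebra_simps)
    then show "u (\<lambda>x. f x + g x) \<le> u f + u g" by simp
  next
    fix f and c :: real assume f: "f \<in> V" and c: "0 < c"
    have "u (\<lambda>x. c * f x) / c \<le> q f" if "q \<in> C" for q
      using u_le[OF that fun_subspace_scale[OF V f, of c]] sublinear_on_scale_le[OF C(1)[OF that] f c] c
      by (simp add: field_simps)
    then have "u (\<lambda>x. c * f x) / c \<le> u f" by (rule u_ge)
    then show "u (\<lambda>x. c * f x) \<le> c * u f" using c by (simp add: field_simps)
  qed
qed

lemma minimal_sublinear_on:
  assumes V: "fun_subspace V" and p: "sublinear_on V p"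
  obtains m where "sublinear_on V m" "\<And>f. f \<in> V \<Longrightarrow> m f \<le> p f"
    "\<And>q f. sublinear_on V q \<Longrightarrow> (\<And>f. f \<in> V \<Longrightarrow> q f \<le> m f) \<Longrightarrow> f \<in> V \<Longrightarrow> q f = m f"
proof -
  \<comment> \<open>Normalizing to \<open>0\<close> off \<open>V\<close> makes the pointwise order on \<open>V\<close> antisymmetric.\<close>
  define A where "A = {q. sublinear_on V q \<and> (\<forall>f\<in>V. q f \<le> p f) \<and> (\<forall>f. f \<notin> V \<longrightarrow> q f = 0)}"
  \<comment> \<open>The order is reversed, so that a maximal element in the sense of Zorn is a
    minimal functional.\<close>
  define P where "P q r \<longleftrightarrow> (\<forall>f\<in>V. r f \<le> q f)" for q r :: "('a \<Rightarrow> real) \<Rightarrow> real"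
  define nrm where "nrm q f = (if f \<in> V then q f else 0)" for q :: "('a \<Rightarrow> real) \<Rightarrow> real" and f
  have nrm_A: "nrm q \<in> A" if "sublinear_on V q" "\<And>f. f \<in> V \<Longrightarrow> q f \<le> p f" for q
    using that V by (auto simp: A_def nrm_def sublinear_on_def fun_subspace_def)
  have "\<exists>m\<in>A. \<forall>a\<in>A. P m a \<longrightarrow> a = m"
  proof (rule predicate_Zorn)
    show "partial_order_on A (relation_of P A)"
    proof (rule partial_order_on_relation_ofI)
      show "a = b" if "a \<in> A" "b \<in> A" "P a b" "P b a" for a b
      proof
        fix f show "a f = b f"
          using that by (cases "f \<in> V") (auto simp: A_def P_def intro: antisym)
      qed
    qed (auto simp: P_def intro: order_trans)
    show "\<exists>u\<in>A. \<forall>a\<in>C. P a u" if C: "C \<in> Chains (relation_of P A)" for C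
    proof (cases "C = {}")
      case True
      then show ?thesis using nrm_A[OF p] by auto
    next
      case False
      have CA: "C \<subseteq> A" and tot: "\<And>q r. q \<in> C \<Longrightarrow> r \<in> C \<Longrightarrow> P q r \<or> P r q"
        using C by (auto simp: Chains_def relation_of_def)
      obtain u where u: "sublinear_on V u" "\<And>q f. q \<in> C \<Longrightarrow> f \<in> V \<Longrightarrow> u f \<le> q f"
        by (rule sublinear_on_chain_bound[OF V p False]) (use CA tot in \<open>auto simp: A_def P_def\<close>)
      have "u f \<le> p f" if "f \<in> V" for f
        using False u(2)[OF _ that] CA that by (fastforce simp: A_def)
      then have "nrm u \<in> A" using u(1) by (intro nrm_A)
      then show ?thesis using u(2) by (intro bexI[of _ "nrm u"]) (auto simp: P_def nrm_def)
    qed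
  qed
  then obtain m where m: "m \<in> A" "\<And>a. a \<in> A \<Longrightarrow> P m a \<Longrightarrow> a = m" by blast
  show thesis
  proof
    show "sublinear_on V m" "\<And>f. f \<in> V \<Longrightarrow> m f \<le> p f"
      using m(1) by (auto simp: A_def)
    show "q f = m f" if q: "sublinear_on V q" "\<And>f. f \<in> V \<Longrightarrow> q f \<le> m f" and f: "f \<in> V" for q f
    proof -
      have "nrm q = m"
        using m(1) q by (intro m(2) nrm_A) (auto simp: A_def P_def nrm_def intro: order_trans)
      then show ?thesis using f by (auto simp: nrm_def)
    qed
  qed
qed

text \<open>
  A minimal sublinear functional \<open>m\<close> cannot be lowered by \<open>sublinear_on_reduce\<close>, so that
  \<open>m (- v) = - m v\<close> for all \<open>v\<close>, which forces \<open>m\<close> to be linear.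
\<close>
theorem hahn_banach_sublinear_on:
  assumes V: "fun_subspace V" and p: "sublinear_on V p" and h: "h \<in> V"
  obtains L where "linear_on_funs V L" "\<And>f. f \<in> V \<Longrightarrow> L f \<le> p f" "L h = p h"
proof -
  \<comment> \<open>Lowering at \<open>h\<close> before minimizing ensures that the linear
    functional found below \<open>q\<close> takes the value \<open>p h\<close> at
    \<open>h\<close>.\<close>
  obtain q where q: "sublinear_on V q" "\<And>f. f \<in> V \<Longrightarrow> q f \<le> p f" "q (\<lambda>x. - h x) \<le> - p h"
    using sublinear_on_reduce[OF V p h] by blast
  obtain m where m: "sublinear_on V m" "\<And>f. f \<in> V \<Longrightarrow> m f \<le> q f"
    and min: "\<And>q f. sublinear_on V q \<Longrightarrow> (\<And>f. f \<in> V \<Longrightarrow> q f \<le> m f) \<Longrightarrow> f \<in> V \<Longrightarrow> q f = m f"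
    by (rule minimal_sublinear_on[OF V q(1)]) blast
  note neg = fun_subspace_uminus[OF V]
  have odd: "m (\<lambda>x. - v x) = - m v" if v: "v \<in> V" for v
  proof (rule antisym)
    obtain r where r: "sublinear_on V r" "\<And>f. f \<in> V \<Longrightarrow> r f \<le> m f" "r (\<lambda>x. - v x) \<le> - m v"
      using sublinear_on_reduce[OF V m(1) v] by blast
    then show "m (\<lambda>x. - v x) \<le> - m v"
      using min[OF r(1,2) neg[OF v]] by simp
    show "- m v \<le> m (\<lambda>x. - v x)"
      using sublinear_on_uminus_ge[OF V m(1) v] by linarith
  qed
  show thesis
  proof
    show "linear_on_funs V m"
      unfolding linear_on_funs_def
    proof (intro conjI ballI allI)
      fix f g assume f: "f \<in> V" and g: "g \<in> V"
      \<comment> \<open>Oddness turns subadditivity at \<open>- f\<close>, \<open>- g\<close> into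
        superadditivity at \<open>f\<close>, \<open>g\<close>.\<close>
      have "- m (\<lambda>x. f x + g x) = m (\<lambda>x. - f x + - g x)"
        using odd[OF fun_subspace_add[OF V f g]] by simp
      also have "\<dots> \<le> m (\<lambda>x. - f x) + m (\<lambda>x. - g x)"
        by (intro sublinear_on_add[OF m(1)] neg f g)
      finally show "m (\<lambda>x. f x + g x) = m f + m g"
        using sublinear_on_add[OF m(1) f g] by (simp add: odd f g)
    next
      fix f and c :: real assume f: "f \<in> V"
      consider "c > 0" | "c = 0" | "c < 0" by linarith
      then show "m (\<lambda>x. c * f x) = c * m f"
      proof cases
        case 1
        then show ?thesis by (rule sublinear_on_scale[OF V m(1) f])
      next
        case 2
        then show ?thesis using sublinear_on_zero[OF V m(1) f] by simp
      next
        case 3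
        then show ?thesis
          using sublinear_on_scale[OF V m(1) f, of "- c"] odd[OF fun_subspace_scale[OF V f, of c]]
          by simp
      qed
    qed
    show le: "m f \<le> p f" if "f \<in> V" for f
      using m(2)[OF that] q(2)[OF that] by linarith
    have "- m h \<le> - p h"
      using m(2)[OF neg[OF h]] q(3) odd[OF h] by linarith
    then show "m h = p h" using le[OF h] by linarith
  qed
qed

section \<open>Algebra of linear functionals on function spaces\<close>

lemma linear_on_funs_add:
    "linear_on_funs V L \<Longrightarrow> f \<in> V \<Longrightarrow> g \<in> V \<Longrightarrow> L (\<lambda>x. f x + g x) = L f + L g"
  and linear_on_funs_scale: "linear_on_funs V L \<Longrightarrow> f \<in> V \<Longrightarrow> L (\<lambda>x. c * f x) = c * L f"
  by (auto simp: linear_on_funs_def)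

lemma linear_on_funs_uminus: "linear_on_funs V L \<Longrightarrow> f \<in> V \<Longrightarrow> L (\<lambda>x. - f x) = - L f"
  using linear_on_funs_scale[of V L f "-1"] by simp

lemma linear_on_funs_diff:
  assumes "fun_subspace V" "linear_on_funs V L" "f \<in> V" "g \<in> V"
  shows "L (\<lambda>x. f x - g x) = L f - L g"
  using linear_on_funs_add[OF assms(2,3) fun_subspace_uminus[OF assms(1,4)]]
    linear_on_funs_uminus[OF assms(2,4)] by simp

text \<open>Meant for step functions: a constant plus weighted indicators. Membership in
  \<open>V\<close> goes through the same induction because additivity at each stage relies on
  it.\<close>

lemma linear_on_funs_sum:
  assumes V: "fun_subspace V" and L: "linear_on_funs V L" and f: "f \<in> V"
    and g: "\<And>i. g i \<in> V"
  shows "L (\<lambda>x. f x + (\<Sum>i<n::nat. c i * g i x)) = L f + (\<Sum>i<n. c i * L (g i))"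
    and "(\<lambda>x. f x + (\<Sum>i<n. c i * g i x)) \<in> V"
proof (induction n)
  case (Suc n)
  have eq: "(\<lambda>x. f x + (\<Sum>i<Suc n. c i * g i x)) =
      (\<lambda>x. (f x + (\<Sum>i<n. c i * g i x)) + c n * g n x)"
    by (simp add: algebra_simps)
  note cg = fun_subspace_scale[OF V g, of "c n" n]
  {
    case 1
    show ?case
      using linear_on_funs_add[OF L Suc(2) cg] Suc(1) linear_on_funs_scale[OF L g]
      unfolding eq by simp
  next
    case 2
    show ?case
      unfolding eq by (rule fun_subspace_add[OF V Suc(2) cg])
  }
qed (use f in simp_all)

subsection \<open>Functions of linear growth\<close>

lemma linear_growthI: "(\<And>x. x \<ge> 0 \<Longrightarrow> \<bar>f x\<bar> \<le> C * (1 + x)) \<Longrightarrow> linear_growth f"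
  unfolding linear_growth_def by (rule bdd_aboveI2[where M = C]) (simp add: field_simps)

lemma linear_growthE:
  assumes "linear_growth f"
  obtains C where "C \<ge> 0" "\<And>x. x \<ge> 0 \<Longrightarrow> \<bar>f x\<bar> \<le> C * (1 + x)"
proof -
  from assms obtain M where M: "\<And>x. x \<ge> 0 \<Longrightarrow> \<bar>f x\<bar> / (1 + \<bar>x\<bar>) \<le> M"
    unfolding linear_growth_def bdd_above_def by auto
  show thesis
  proof
    show "M \<ge> 0" using M[of 0] by simp
    show "\<bar>f x\<bar> \<le> M * (1 + x)" if "x \<ge> 0" for x
      using M[OF that] that by (simp add: field_simps)
  qed
qed

lemma linear_growth_bounded: "(\<And>x. x \<ge> 0 \<Longrightarrow> \<bar>f x\<bar> \<le> C) \<Longrightarrow> linear_growth f"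
proof (rule linear_growthI)
  fix x :: real
  assume f: "\<And>x. x \<ge> 0 \<Longrightarrow> \<bar>f x\<bar> \<le> C" and x: "x \<ge> 0"
  have "C * x \<ge> 0" using f[of 0] x by (intro mult_nonneg_nonneg) auto
  then show "\<bar>f x\<bar> \<le> C * (1 + x)" using f[OF x] by (simp add: algebra_simps)
qed

lemma linear_growth_const: "linear_growth (\<lambda>x. c)"
  by (rule linear_growth_bounded) auto

lemma linear_growth_indicator: "linear_growth (indicat_real A)"
  by (rule linear_growth_bounded[where C = 1]) (simp add: indicator_def)

lemma linear_growth_call: "linear_growth (\<lambda>x. max 0 (x - k))"
proof (rule linear_growthI)
  fix x :: real assume "x \<ge> 0"
  then have "0 \<le> \<bar>k\<bar> * x" by simp
  then show "\<bar>max 0 (x - k)\<bar> \<le> (1 + \<bar>k\<bar>) * (1 + x)"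
    using \<open>x \<ge> 0\<close> unfolding distrib_left distrib_right by linarith
qed

lemma linear_growth_ident: "linear_growth (\<lambda>x. x)"
  by (rule linear_growthI[where C = 1]) auto

lemma fun_subspace_linear_growth: "fun_subspace {f. linear_growth f}"
  unfolding fun_subspace_def mem_Collect_eq
proof (intro conjI ballI allI; unfold mem_Collect_eq)
  fix f g assume "linear_growth f" "linear_growth g"
  then obtain C D where C: "\<And>x. x \<ge> 0 \<Longrightarrow> \<bar>f x\<bar> \<le> C * (1 + x)"
    and D: "\<And>x. x \<ge> 0 \<Longrightarrow> \<bar>g x\<bar> \<le> D * (1 + x)"
    by (metis linear_growthE)
  show "linear_growth (\<lambda>x. f x + g x)"
  proof (rule linear_growthI[where C = "C + D"])
    fix x :: real assume "x \<ge> 0"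
    then show "\<bar>f x + g x\<bar> \<le> (C + D) * (1 + x)"
      using C[of x] D[of x] abs_triangle_ineq[of "f x" "g x"] unfolding distrib_right by linarith
  qed
next
  fix f and c :: real assume "linear_growth f"
  then obtain C where C: "\<And>x. x \<ge> 0 \<Longrightarrow> \<bar>f x\<bar> \<le> C * (1 + x)"
    by (metis linear_growthE)
  show "linear_growth (\<lambda>x. c * f x)"
  proof (rule linear_growthI[where C = "\<bar>c\<bar> * C"])
    fix x :: real assume "x \<ge> 0"
    then show "\<bar>c * f x\<bar> \<le> \<bar>c\<bar> * C * (1 + x)"
      using mult_left_mono[OF C[of x], of "\<bar>c\<bar>"] by (simp add: abs_mult mult.assoc)
  qed
qed

lemma linear_growth_add: "linear_growth f \<Longrightarrow> linear_growth g \<Longrightarrow> linear_growth (\<lambda>x. f x + g x)"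
  and linear_growth_cmult: "linear_growth f \<Longrightarrow> linear_growth (\<lambda>x. c * f x)"
  and linear_growth_uminus: "linear_growth f \<Longrightarrow> linear_growth (\<lambda>x. - f x)"
  using fun_subspace_add[OF fun_subspace_linear_growth] fun_subspace_scale[OF fun_subspace_linear_growth]
    fun_subspace_uminus[OF fun_subspace_linear_growth] by auto

lemma linear_growth_diff: "linear_growth f \<Longrightarrow> linear_growth g \<Longrightarrow> linear_growth (\<lambda>x. f x - g x)"
  using linear_growth_add[OF _ linear_growth_uminus, of f g] by simp

section \<open>Integrability under measures in \<open>P1\<close>\<close>

lemma space_P1: "\<mu> \<in> P1 \<Longrightarrow> space \<mu> = {0..}"
  using sets_eq_imp_space_eq[of \<mu> borel_Rplus]
  by (auto simp: P1_def borel_Rplus_def space_restrict_space)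

lemma borel_measurable_P1: "\<mu> \<in> P1 \<Longrightarrow> borel_measurable \<mu> = borel_measurable (restrict_space borel {0..})"
  by (rule measurable_cong_sets) (auto simp: P1_def borel_Rplus_def)

lemma integrable_P1:
  assumes \<mu>: "\<mu> \<in> P1" and f: "f \<in> borel_measurable (restrict_space borel {0..})" "linear_growth f"
  shows "integrable \<mu> f"
proof -
  from \<mu> interpret prob_space \<mu> by (simp add: P1_def)
  obtain C where C: "\<And>x. x \<ge> 0 \<Longrightarrow> \<bar>f x\<bar> \<le> C * (1 + x)"
    using f(2) by (metis linear_growthE)
  show ?thesis
  proof (rule Bochner_Integration.integrable_bound)
    show "integrable \<mu> (\<lambda>x. C * (1 + x))"
      using \<mu> by (auto simp: P1_def)
    show "f \<in> borel_measurable \<mu>"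
      using f(1) by (simp add: borel_measurable_P1[OF \<mu>])
    show "AE x in \<mu>. norm (f x) \<le> norm (C * (1 + x))"
      using C by (intro AE_I2) (fastforce simp: space_P1[OF \<mu>])
  qed
qed

lemma integrable_P1_continuous:
  "\<mu> \<in> P1 \<Longrightarrow> continuous_on {0..} f \<Longrightarrow> linear_growth f \<Longrightarrow> integrable \<mu> f"
  by (rule integrable_P1[OF _ borel_measurable_continuous_on_restrict])

subsection \<open>Representation of positive linear functionals\<close>

text \<open>
  A finitely additive distribution function need not be right continuous; its right-continuous
  version is squeezed between its values at neighbouring points.
\<close>
lemma cdf_of_mono:
  fixes F :: "real \<Rightarrow> real"
  assumes mono: "\<And>x y. x \<le> y \<Longrightarrow> F x \<le> F y"
    and bot: "(F \<longlongrightarrow> 0) at_bot" and top: "(F \<longlongrightarrow> 1) at_top"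
  obtains M where "real_distribution M" "\<And>t. F t \<le> cdf M t" "\<And>s t. s < t \<Longrightarrow> cdf M s \<le> F t"
proof -
  define G where "G t = (INF s\<in>{t<..}. F s)" for t
  have bdd: "bdd_below (F ` {t<..})" for t
    by (rule bdd_belowI2[where m = "F t"]) (auto intro: mono)
  have G_le: "G s \<le> F t" if "s < t" for s t
    unfolding G_def using that by (intro cINF_lower bdd) auto
  have G_ge: "m \<le> G t" if "\<And>s. t < s \<Longrightarrow> m \<le> F s" for m t
    unfolding G_def using that by (intro cINF_greatest) auto
  have F_le: "F t \<le> G t" for t
    by (rule G_ge) (auto intro: mono)
  have G_mono: "G x \<le> G y" if "x \<le> y" for x y
    by (rule G_ge) (use that in \<open>auto intro: G_le\<close>)
  have G_right: "continuous (at_right a) G" for a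
    unfolding continuous_within
  proof (rule order_tendstoI)
    fix l assume "l < G a"
    then have "l < G x" if "a < x" for x
      using G_mono[of a x] that by linarith
    then show "\<forall>\<^sub>F x in at_right a. l < G x"
      by (auto simp: eventually_at_filter intro!: always_eventually)
  next
    fix u assume u: "G a < u"
    then obtain s where s: "s > a" "F s < u"
      using G_ge[of a u] by (meson not_le)
    then show "\<forall>\<^sub>F x in at_right a. G x < u"
      unfolding eventually_at_right_field by (metis G_le le_less_trans)
  qed
  \<comment> \<open>Both limits of \<open>G\<close> come from
    \<open>F x \<le> G x \<le> F (1 + x)\<close>.\<close>
  have G_bot: "(G \<longlongrightarrow> 0) at_bot"
  proof (rule tendsto_sandwich[OF _ _ bot])
    have "filterlim (\<lambda>x::real. 1 + x) at_bot at_bot"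
      unfolding filterlim_at_bot
    proof
      fix Z :: real
      show "\<forall>\<^sub>F x in at_bot. 1 + x \<le> Z"
        using eventually_le_at_bot[of "Z - 1"] by eventually_elim simp
    qed
    then show "((\<lambda>x. F (1 + x)) \<longlongrightarrow> 0) at_bot"
      by (rule filterlim_compose[OF bot])
  qed (auto intro!: always_eventually F_le G_le)
  have G_top: "(G \<longlongrightarrow> 1) at_top"
  proof (rule tendsto_sandwich[OF _ _ top])
    show "((\<lambda>x. F (1 + x)) \<longlongrightarrow> 1) at_top"
      by (intro filterlim_compose[OF top] filterlim_tendsto_add_at_top[OF tendsto_const filterlim_ident])
  qed (auto intro!: always_eventually F_le G_le)
  show thesis
  proof
    show "real_distribution (interval_measure G)"
      by (rule real_distribution_interval_measure[OF G_mono G_right G_bot G_top])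
    have "cdf (interval_measure G) = G"
      by (rule cdf_interval_measure[OF G_mono G_right G_bot])
    then show "F t \<le> cdf (interval_measure G) t" "s < t \<Longrightarrow> cdf (interval_measure G) s \<le> F t" for s t
      by (auto intro: F_le G_le)
  qed
qed

text \<open>The jump at \<open>t i\<close> carries the sum from \<open>f (t i)\<close> to
  \<open>f (t (Suc i))\<close>, so on the left-open interval from \<open>t i\<close> to
  \<open>t (Suc i)\<close> it equals the value of \<open>f\<close> at the right endpoint. Rays are
  used instead of intervals so that integrating the sum involves only distribution functions at the
  grid points.\<close>

lemma step_approximation:
  fixes f :: "real \<Rightarrow> real" and t :: "nat \<Rightarrow> real"
  assumes t: "t 0 = 0" "\<And>i. t i \<le> t (Suc i)"
    and osc: "\<And>i x. i < n \<Longrightarrow> t i < x \<Longrightarrow> x \<le> t (Suc i) \<Longrightarrow> \<bar>f (t (Suc i)) - f x\<bar> \<le> e"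
    and e: "e \<ge> 0" and x: "x \<ge> 0"
  defines "s \<equiv> f 0 + (\<Sum>i<n. (f (t (Suc i)) - f (t i)) * indicat_real {t i<..} x)"
  shows "x \<le> t n \<Longrightarrow> \<bar>s - f x\<bar> \<le> e" and "t n < x \<Longrightarrow> s = f (t n)"
proof -
  \<comment> \<open>The exact value beyond \<open>t m\<close> belongs to the induction claim, since
    the next jump starts from it.\<close>
  have "(x \<le> t m \<longrightarrow> \<bar>f 0 + (\<Sum>i<m. (f (t (Suc i)) - f (t i)) * indicat_real {t i<..} x) - f x\<bar> \<le> e) \<and>
      (t m < x \<longrightarrow> f 0 + (\<Sum>i<m. (f (t (Suc i)) - f (t i)) * indicat_real {t i<..} x) = f (t m))"
    if "m \<le> n" for m
    using that
  proof (induction m)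
    case 0
    then show ?case using e x t(1) by auto
  next
    case (Suc m)
    then have m: "m < n" by simp
    consider "x \<le> t m" | "t m < x" by linarith
    then show ?case
    proof cases
      case 1
      then show ?thesis using Suc t(2)[of m] by auto
    next
      case 2
      then show ?thesis using Suc osc[OF m 2] by auto
    qed
  qed
  then show "x \<le> t n \<Longrightarrow> \<bar>s - f x\<bar> \<le> e" and "t n < x \<Longrightarrow> s = f (t n)"
    unfolding s_def by auto
qed

text \<open>A finitely additive mean on all functions of linear growth, measurable or not. The
  assumption \<open>tail\<close> keeps mass and first moment from escaping to infinity, which is
  what makes \<open>L\<close> an integral on continuous functions.\<close>

locale tight_mean =
  fixes L :: "(real \<Rightarrow> real) \<Rightarrow> real"
  assumes linear: "linear_on_funs {f. linear_growth f} L"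
    and mono: "\<And>f g. linear_growth f \<Longrightarrow> linear_growth g \<Longrightarrow> (\<And>x. x \<ge> 0 \<Longrightarrow> f x \<le> g x) \<Longrightarrow> L f \<le> L g"
    and one: "L (\<lambda>x. 1) = 1"
    and tail: "(\<lambda>n. L (\<lambda>x. max 0 (x - real n))) \<longlonglongrightarrow> 0"
begin

lemma cmult: "linear_growth f \<Longrightarrow> L (\<lambda>x. c * f x) = c * L f"
  and diff: "linear_growth f \<Longrightarrow> linear_growth g \<Longrightarrow> L (\<lambda>x. f x - g x) = L f - L g"
  using linear_on_funs_scale[OF linear] linear_on_funs_diff[OF fun_subspace_linear_growth linear]
  by auto

lemma const: "L (\<lambda>x. c) = c"
  using cmult[OF linear_growth_const, of c 1] one by simp

lemma cong: "linear_growth f \<Longrightarrow> linear_growth g \<Longrightarrow> (\<And>x. x \<ge> 0 \<Longrightarrow> f x = g x) \<Longrightarrow> L f = L g"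
  by (intro antisym mono) auto

text \<open>Continuity of \<open>L\<close> in a weighted norm: the weight \<open>1\<close> serves
  uniform approximation, a call \<open>max 0 (x - k)\<close> serves truncation.\<close>

lemma abs_diff_le:
  assumes f: "linear_growth f" and g: "linear_growth g" and w: "linear_growth w"
    and le: "\<And>x. x \<ge> 0 \<Longrightarrow> \<bar>f x - g x\<bar> \<le> c * w x"
  shows "\<bar>L f - L g\<bar> \<le> c * L w"
proof -
  have "L (\<lambda>x. f x - g x) \<le> L (\<lambda>x. c * w x)" "L (\<lambda>x. g x - f x) \<le> L (\<lambda>x. c * w x)"
    using f g w le by (auto intro!: mono linear_growth_diff linear_growth_cmult simp: abs_le_iff)
  then show ?thesis
    using f g w by (auto simp: cmult diff)
qed

definition "F t = L (indicat_real {..t})"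

lemma F_mono: "s \<le> t \<Longrightarrow> F s \<le> F t"
  unfolding F_def by (intro mono linear_growth_indicator) (auto simp: indicator_def)

lemma F_bounds: "0 \<le> F t" "F t \<le> 1"
  using mono[OF linear_growth_const[of 0] linear_growth_indicator[of "{..t}"]]
    mono[OF linear_growth_indicator[of "{..t}"] linear_growth_const[of 1]]
  by (auto simp: F_def const)

lemma L_indicator_greaterThan: "L (indicat_real {t<..}) = 1 - F t"
proof -
  have "indicat_real {t<..} = (\<lambda>x. 1 - indicat_real {..t} x)"
    by (auto simp: indicator_def)
  then show ?thesis
    using diff[OF linear_growth_const[of 1] linear_growth_indicator[of "{..t}"]]
    by (simp add: F_def one)
qed

lemma F_at_bot: "(F \<longlongrightarrow> 0) at_bot"
proof (rule tendsto_eventually)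
  have "F t = 0" if "t < 0" for t
    using cong[OF linear_growth_indicator linear_growth_const, of "{..t}" 0] that
    by (auto simp: F_def const indicator_def)
  then show "\<forall>\<^sub>F t in at_bot. F t = 0"
    by (auto simp: eventually_at_bot_dense)
qed

lemma F_at_top: "(F \<longlongrightarrow> 1) at_top"
proof (rule order_tendstoI)
  fix l :: real assume "l < 1"
  then have "\<forall>\<^sub>F n in sequentially. L (\<lambda>x. max 0 (x - real n)) < 1 - l"
    using order_tendstoD(2)[OF tail, of "1 - l"] by simp
  then obtain n where n: "L (\<lambda>x. max 0 (x - real n)) < 1 - l"
    using eventually_sequentially by auto
  have "l < F t" if "t \<ge> real n + 1" for t
  proof -
    \<comment> \<open>A Markov bound: for \<open>x > t \<ge> n + 1\<close> the call with strike
      \<open>n\<close> is at least \<open>1\<close>.\<close>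
    have "L (indicat_real {t<..}) \<le> L (\<lambda>x. max 0 (x - real n))"
      using that by (intro mono linear_growth_indicator linear_growth_call) (auto simp: indicator_def)
    then show ?thesis using n by (simp add: L_indicator_greaterThan)
  qed
  then show "\<forall>\<^sub>F t in at_top. l < F t"
    by (auto simp: eventually_at_top_linorder)
next
  fix u :: real assume "1 < u"
  then have "F t < u" for t using F_bounds(2)[of t] by linarith
  then show "\<forall>\<^sub>F t in at_top. F t < u" by simp
qed

text \<open>A Riemann-Stieltjes argument. Being constant beyond \<open>K\<close>, \<open>f\<close>
  is a uniform limit of step functions, and on these \<open>L\<close> and \<open>M\<close> are
  finite sums in \<open>F\<close> and \<open>cdf M\<close>. Replacing \<open>f\<close> by a step
  function costs \<open>e\<close> on each side, exchanging \<open>F\<close> for \<open>cdf M\<close>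
  a third \<open>e\<close>. As \<open>M\<close> lives on the whole line, \<open>f\<close> enters
  through \<open>max 0 x\<close>.\<close>

lemma L_eq_expectation_truncated:
  assumes M: "real_distribution M"
    and FM: "\<And>t. F t \<le> cdf M t" "\<And>s t. s < t \<Longrightarrow> cdf M s \<le> F t"
    and f: "continuous_on {0..} f" and K: "K > 0" "\<And>x. x \<ge> K \<Longrightarrow> f x = f K"
    and lg: "linear_growth f"
  shows "integrable M (\<lambda>x. f (max 0 x))" "L f = (LINT x|M. f (max 0 x))"
proof -
  interpret M: real_distribution M by fact
  have "continuous_on UNIV (\<lambda>x. f (max 0 x))"
    by (rule continuous_on_compose2[OF f]) (auto intro!: continuous_intros)
  then have "(\<lambda>x. f (max 0 x)) \<in> borel_measurable borel"
    by (rule borel_measurable_continuous_onI)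
  then have meas: "(\<lambda>x. f (max 0 x)) \<in> borel_measurable M"
    by simp
  have comp: "compact (f ` {0..K})"
    by (intro compact_continuous_image continuous_on_subset[OF f]) auto
  then obtain B where B: "\<And>x. x \<in> {0..K} \<Longrightarrow> \<bar>f x\<bar> \<le> B"
    by (metis bounded_iff compact_imp_bounded imageI real_norm_def)
  have "\<bar>f (max 0 x)\<bar> \<le> B" for x
  proof (cases "x \<le> K")
    case True
    then show ?thesis using K(1) by (intro B) auto
  next
    case False
    then show ?thesis using K(1) K(2)[of x] B[of K] by (simp add: max_def)
  qed
  then show intf: "integrable M (\<lambda>x. f (max 0 x))"
    using meas by (intro M.integrable_const_bound[where B = B]) auto
  have "\<bar>L f - (LINT x|M. f (max 0 x))\<bar> \<le> 3 * e" if e: "e > 0" for e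
  proof -
    have unif: "uniformly_continuous_on {0..K} f"
      by (intro compact_uniformly_continuous continuous_on_subset[OF f]) auto
    obtain d where d: "d > 0"
      and fd: "\<And>x y. x \<in> {0..K} \<Longrightarrow> y \<in> {0..K} \<Longrightarrow> dist y x < d \<Longrightarrow> dist (f y) (f x) < e"
      using uniformly_continuous_onE[OF unif e] by blast
    \<comment> \<open>The mesh \<open>K / N\<close> of the grid from \<open>t 0 = 0\<close> to
      \<open>t N = K\<close> falls below the modulus of continuity \<open>d\<close>.\<close>
    obtain N :: nat where N: "K / d < real N"
      using reals_Archimedean2 by blast
    have N0: "N > 0"
      using divide_pos_pos[OF K(1) d] N by linarith
    define t where "t i = real i * (K / real N)" for i :: nat
    have KN: "0 < K / real N" "K / real N < d"
      using N N0 K(1) d by (auto simp: field_simps)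
    have t0: "t 0 = 0" and tN: "t N = K" and tSuc: "t (Suc i) = t i + K / real N" for i
      using N0 by (auto simp: t_def field_simps)
    have t_mono: "t i \<le> t j" if "i \<le> j" for i j
      unfolding t_def using that KN(1) by (intro mult_right_mono) auto
    have t_less: "t i < t (Suc i)" for i
      using KN(1) by (simp add: tSuc)
    have t_mem: "t i \<in> {0..K}" if "i \<le> N" for i
      using t_mono[of 0 i] t_mono[OF that] by (simp add: t0 tN)
    define c where "c i = f (t (Suc i)) - f (t i)" for i
    have osc: "\<bar>f (t (Suc i)) - f x\<bar> \<le> e" if "i < N" "t i \<le> x" "x \<le> t (Suc i)" for i x
    proof -
      have "x \<in> {0..K}"
        using t_mem[of i] t_mem[of "Suc i"] that by auto
      then show ?thesis
        using fd[of x "t (Suc i)"] t_mem[of "Suc i"] that KN(2) by (auto simp: dist_real_def tSuc)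
    qed
    have c_le: "\<bar>c i\<bar> \<le> e" if "i < N" for i
      unfolding c_def using osc[OF that, of "t i"] t_less[of i] by simp
    define s where "s x = f 0 + (\<Sum>i<N. c i * indicat_real {t i<..} x)" for x
    have s_approx: "\<bar>f x - s x\<bar> \<le> e" if "x \<ge> 0" for x
    proof -
      note step = step_approximation[of t N f e x, OF t0 less_imp_le[OF t_less] osc less_imp_le[OF e] that,
        folded c_def, folded s_def]
      show ?thesis
      proof (cases "x \<le> K")
        case True
        then show ?thesis using step(1) by (simp add: tN abs_minus_commute)
      next
        case False
        then show ?thesis using step(2) K(2)[of x] e by (simp add: tN)
      qed
    qed
    have s_lg: "linear_growth s" and Ls: "L s = f 0 + (\<Sum>i<N. c i * (1 - F (t i)))"
      using linear_on_funs_sum[OF fun_subspace_linear_growth linear,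
          of "\<lambda>x. f 0" "\<lambda>i. indicat_real {t i<..}" c N]
      unfolding s_def by (simp_all add: linear_growth_const linear_growth_indicator const
          L_indicator_greaterThan)
    have 1: "\<bar>L f - L s\<bar> \<le> e"
      using abs_diff_le[OF lg s_lg linear_growth_const[of 1], of e] s_approx by (simp add: one)
    \<comment> \<open>All \<open>t i\<close> are nonnegative, so clipping \<open>x\<close> at
      \<open>0\<close> does not change on which side of \<open>t i\<close> it lies.\<close>
    have s_max: "s (max 0 x) = f 0 + (\<Sum>i<N. c i * indicat_real {t i<..} x)" for x
    proof -
      have "indicat_real {t i<..} (max 0 x) = indicat_real {t i<..} x" for i
        using t_mono[of 0 i] by (auto simp: t0 indicator_def max_def)
      then show ?thesis by (simp add: s_def)
    qed
    have int_ind: "integrable M (indicat_real {t i<..})" for i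
      by (intro integrable_real_indicator) (auto simp: M.emeasure_eq_measure)
    have int_c: "integrable M (\<lambda>x. c i * indicat_real {t i<..} x)" for i
      using int_ind by (rule integrable_mult_right)
    have ints: "integrable M (\<lambda>x. s (max 0 x))"
      unfolding s_max by (intro Bochner_Integration.integrable_add
          Bochner_Integration.integrable_sum int_c) simp
    have M_greaterThan: "measure M {u<..} = 1 - cdf M u" for u
    proof -
      have "{u<..} = space M - {..u}" by auto
      then show ?thesis using M.prob_compl[of "{..u}"] by (simp add: cdf_def)
    qed
    have Ms: "(LINT x|M. s (max 0 x)) = f 0 + (\<Sum>i<N. c i * (1 - cdf M (t i)))"
    proof -
      have "(LINT x|M. s (max 0 x)) =
          (LINT x|M. f 0) + (LINT x|M. (\<Sum>i<N. c i * indicat_real {t i<..} x))"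
        unfolding s_max
        by (intro Bochner_Integration.integral_add Bochner_Integration.integrable_sum int_c) simp
      also have "(LINT x|M. (\<Sum>i<N. c i * indicat_real {t i<..} x)) =
          (\<Sum>i<N. LINT x|M. c i * indicat_real {t i<..} x)"
        by (intro Bochner_Integration.integral_sum int_c)
      also have "\<dots> = (\<Sum>i<N. c i * (1 - cdf M (t i)))"
        by (simp add: M_greaterThan)
      finally show ?thesis by (simp add: M.prob_space[simplified])
    qed
    have 2: "\<bar>(LINT x|M. f (max 0 x)) - (LINT x|M. s (max 0 x))\<bar> \<le> e"
    proof -
      have "\<bar>(LINT x|M. f (max 0 x) - s (max 0 x))\<bar> \<le> (LINT x|M. \<bar>f (max 0 x) - s (max 0 x)\<bar>)"
        by (rule integral_abs_bound)
      also have "\<dots> \<le> (LINT x|M. e)"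
        using intf ints by (intro integral_mono s_approx) auto
      also have "\<dots> = e" using M.prob_space by simp
      finally show ?thesis using intf ints by simp
    qed
    \<comment> \<open>The two distribution functions differ at \<open>t i\<close> by at most the increment of \<open>F\<close> over
      \<open>[t i, t (i + 1)]\<close>, and these increments add up to at most \<open>1\<close>.\<close>
    have "\<bar>L s - (LINT x|M. s (max 0 x))\<bar> = \<bar>\<Sum>i<N. c i * (cdf M (t i) - F (t i))\<bar>"
      unfolding Ls Ms by (simp add: sum_subtractf[symmetric] algebra_simps)
    also have "\<dots> \<le> (\<Sum>i<N. \<bar>c i * (cdf M (t i) - F (t i))\<bar>)"
      by (rule sum_abs)
    also have "\<dots> \<le> (\<Sum>i<N. e * (F (t (Suc i)) - F (t i)))"
    proof (rule sum_mono)
      fix i assume "i \<in> {..<N}"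
      then have "\<bar>c i\<bar> * \<bar>cdf M (t i) - F (t i)\<bar> \<le> e * (F (t (Suc i)) - F (t i))"
        using FM(1)[of "t i"] FM(2)[OF t_less[of i]] c_le[of i] e by (intro mult_mono) auto
      then show "\<bar>c i * (cdf M (t i) - F (t i))\<bar> \<le> e * (F (t (Suc i)) - F (t i))"
        by (simp add: abs_mult)
    qed
    also have "\<dots> = e * (F (t N) - F (t 0))"
      using sum_lessThan_telescope[of "\<lambda>i. F (t i)" N] by (simp add: sum_distrib_left[symmetric])
    also have "\<dots> \<le> e * 1"
      using e F_bounds(2)[of "t N"] F_bounds(1)[of "t 0"] by (intro mult_left_mono) auto
    finally show ?thesis using 1 2 by linarith
  qed
  \<comment> \<open>With a sixth of the difference as \<open>e\<close>, a nonzero difference would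
    be at most half of itself.\<close>
  from this[of "\<bar>L f - (LINT x|M. f (max 0 x))\<bar> / 6"]
  show "L f = (LINT x|M. f (max 0 x))" by (cases "L f = (LINT x|M. f (max 0 x))") auto
qed

text \<open>The truncations \<open>f (min x K)\<close> are handled by
  \<open>L_eq_expectation_truncated\<close>. Letting \<open>K\<close> grow, the integrals converge
  by domination, the values of \<open>L\<close> by \<open>tail\<close>.\<close>

theorem representation:
  obtains \<mu> where "\<mu> \<in> P1"
    "\<And>f. continuous_on {0..} f \<Longrightarrow> linear_growth f \<Longrightarrow> (LINT x|\<mu>. f x) = L f"
proof -
  obtain M where M: "real_distribution M"
    and FM: "\<And>t. F t \<le> cdf M t" "\<And>s t. s < t \<Longrightarrow> cdf M s \<le> F t"
    using cdf_of_mono[OF F_mono F_at_bot F_at_top] by blast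
  interpret M: real_distribution M by fact
  define \<mu> where "\<mu> = distr M borel_Rplus (max 0)"
  have max0: "max 0 \<in> measurable M borel_Rplus"
    unfolding borel_Rplus_def by (rule measurable_restrict_space2) (auto simp: max_def)
  have trunc: "integrable M (\<lambda>x. f (min (max 0 x) K))"
    "L (\<lambda>x. f (min x K)) = (LINT x|M. f (min (max 0 x) K))"
    if f: "continuous_on {0..} f" "linear_growth f" and K: "K > 0" for f K
  proof -
    have 1: "continuous_on {0..} (\<lambda>x. f (min x K))"
      using K by (intro continuous_on_compose2[OF f(1)] continuous_intros) auto
    obtain C where C: "C \<ge> 0" "\<And>x. x \<ge> 0 \<Longrightarrow> \<bar>f x\<bar> \<le> C * (1 + x)"
      using linear_growthE[OF f(2)] by blast
    have 2: "linear_growth (\<lambda>x. f (min x K))"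
    proof (rule linear_growth_bounded)
      fix x :: real assume "x \<ge> 0"
      then show "\<bar>f (min x K)\<bar> \<le> C * (1 + K)"
        using C(2)[of "min x K"] mult_left_mono[OF _ C(1), of "1 + min x K" "1 + K"] K by simp
    qed
    have 3: "f (min x K) = f (min K K)" if "x \<ge> K" for x
      using that by simp
    show "integrable M (\<lambda>x. f (min (max 0 x) K))"
      "L (\<lambda>x. f (min x K)) = (LINT x|M. f (min (max 0 x) K))"
      using L_eq_expectation_truncated[OF M FM 1 K 3 2] by auto
  qed
  \<comment> \<open>The truncated means increase and stay below \<open>L (\<lambda>x. x)\<close>;
    monotone convergence then gives the first moment.\<close>
  have int_id: "integrable M (\<lambda>x. max 0 x)"
  proof -
    define I where "I n = (LINT x|M. min (max 0 x) (real (Suc n)))" for n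
    have tr: "integrable M (\<lambda>x. min (max 0 x) (real (Suc n)))" "I n = L (\<lambda>x. min x (real (Suc n)))" for n
      using trunc[of "\<lambda>x. x" "real (Suc n)"] by (auto simp: I_def linear_growth_ident)
    have "I n \<le> L (\<lambda>x. x)" for n
      unfolding tr(2) by (intro mono linear_growth_ident linear_growth_bounded[where C = "real (Suc n)"]) auto
    moreover have "incseq I"
      unfolding I_def by (intro incseq_SucI integral_mono tr(1)) auto
    ultimately obtain l where l: "I \<longlonglongrightarrow> l"
      by (metis incseq_convergent)
    show ?thesis
    proof (rule integral_monotone_convergence_nonneg(1)[OF tr(1) _ _ _ l[unfolded I_def]])
      show "AE x in M. (\<lambda>n. min (max 0 x) (real (Suc n))) \<longlonglongrightarrow> max 0 x"
      proof (intro AE_I2 tendsto_eventually)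
        fix x :: real
        obtain n :: nat where "max 0 x < real n" using reals_Archimedean2 by blast
        then show "\<forall>\<^sub>F n in sequentially. min (max 0 x) (real (Suc n)) = max 0 x"
          by (auto simp: eventually_sequentially intro!: exI[of _ n])
      qed
    qed (auto simp: mono_def)
  qed
  show thesis
  proof
    have id: "(\<lambda>x. x) \<in> borel_measurable borel_Rplus"
      unfolding borel_Rplus_def by (intro borel_measurable_continuous_on_restrict continuous_intros)
    show "\<mu> \<in> P1"
      unfolding P1_def \<mu>_def using int_id M.prob_space_distr[OF max0]
      by (simp add: integrable_distr_eq[OF max0 id])
    fix f assume f: "continuous_on {0..} f" "linear_growth f"
    then obtain C where C: "C \<ge> 0" "\<And>x. x \<ge> 0 \<Longrightarrow> \<bar>f x\<bar> \<le> C * (1 + x)"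
      by (metis linear_growthE)
    \<comment> \<open>Truncation happens at twice the strike \<open>n + 1\<close>: beyond
      \<open>a n\<close> the call is at least \<open>x / 2\<close> and thus controls
      \<open>1 + x\<close> up to a constant.\<close>
    define a where "a n = 2 * real (Suc n)" for n
    have a0: "a n > 0" for n by (simp add: a_def)
    have fmeas: "f \<in> borel_measurable borel_Rplus"
      unfolding borel_Rplus_def by (rule borel_measurable_continuous_on_restrict[OF f(1)])
    have "(\<lambda>n. LINT x|M. f (min (max 0 x) (a n))) \<longlonglongrightarrow> (LINT x|M. f (max 0 x))"
    proof (rule integral_dominated_convergence[where w = "\<lambda>x. C * (1 + max 0 x)"])
      show "(\<lambda>x. f (max 0 x)) \<in> borel_measurable M"
        using measurable_compose[OF max0 fmeas] .
      show "(\<lambda>x. f (min (max 0 x) (a n))) \<in> borel_measurable M" for n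
        using trunc(1)[OF f a0] by (rule borel_measurable_integrable)
      show "integrable M (\<lambda>x. C * (1 + max 0 x))"
        using int_id by simp
      show "AE x in M. (\<lambda>n. f (min (max 0 x) (a n))) \<longlonglongrightarrow> f (max 0 x)"
      proof (intro AE_I2 tendsto_eventually)
        fix x :: real
        obtain n :: nat where n: "max 0 x < real n" using reals_Archimedean2 by blast
        have "min (max 0 x) (a m) = max 0 x" if "m \<ge> n" for m
          using n that by (simp add: a_def)
        then show "\<forall>\<^sub>F n in sequentially. f (min (max 0 x) (a n)) = f (max 0 x)"
          unfolding eventually_sequentially by (intro exI[of _ n]) simp
      qed
      show "AE x in M. norm (f (min (max 0 x) (a n))) \<le> C * (1 + max 0 x)" for n
      proof (intro AE_I2)
        fix x :: real
        have "\<bar>f (min (max 0 x) (a n))\<bar> \<le> C * (1 + min (max 0 x) (a n))"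
          using a0[of n] by (intro C(2)) auto
        also have "\<dots> \<le> C * (1 + max 0 x)"
          using C(1) by (intro mult_left_mono) auto
        finally show "norm (f (min (max 0 x) (a n))) \<le> C * (1 + max 0 x)" by simp
      qed
    qed
    then have lim_M: "(\<lambda>n. L (\<lambda>x. f (min x (a n)))) \<longlonglongrightarrow> (LINT x|M. f (max 0 x))"
      using trunc(2)[OF f a0] by simp
    \<comment> \<open>No dominated convergence holds for \<open>L\<close> as such; instead the
      truncation error is bounded by a multiple of a call, whose value vanishes by
      \<open>tail\<close>.\<close>
    have lim_L: "(\<lambda>n. L (\<lambda>x. f (min x (a n)))) \<longlonglongrightarrow> L f"
    proof (rule LIM_zero_cancel, rule Lim_null_comparison)
      show "(\<lambda>n. 8 * C * L (\<lambda>x. max 0 (x - real (Suc n)))) \<longlonglongrightarrow> 0"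
        using tendsto_mult_left[OF LIMSEQ_Suc[OF tail], of "8 * C"] by simp
      show "\<forall>\<^sub>F n in sequentially.
          norm (L (\<lambda>x. f (min x (a n))) - L f) \<le> 8 * C * L (\<lambda>x. max 0 (x - real (Suc n)))"
      proof (rule always_eventually, rule allI)
        fix n
        have bd: "\<bar>f (min x (a n))\<bar> \<le> C * (1 + x)" if "x \<ge> 0" for x
          using C(2)[of "min x (a n)"] mult_left_mono[OF _ C(1), of "1 + min x (a n)" "1 + x"]
            a0[of n] that by simp
        have "\<bar>f (min x (a n)) - f x\<bar> \<le> 8 * C * max 0 (x - real (Suc n))" if "x \<ge> 0" for x
        proof (cases "x \<le> a n")
          case True
          then show ?thesis using C(1) by simp
        next
          case False
          have "\<bar>f (min x (a n)) - f x\<bar> \<le> C * (2 * (1 + x))"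
            using bd[OF that] C(2)[OF that] by linarith
          \<comment> \<open>Here \<open>x > 2 (n + 1) \<ge> 2\<close>, hence
            \<open>8 (x - (n + 1)) \<ge> 4 x \<ge> 2 (1 + x)\<close>.\<close>
          also have "\<dots> \<le> C * (8 * max 0 (x - real (Suc n)))"
            using False C(1) by (intro mult_left_mono) (auto simp: a_def)
          finally show ?thesis by simp
        qed
        then show "norm (L (\<lambda>x. f (min x (a n))) - L f) \<le> 8 * C * L (\<lambda>x. max 0 (x - real (Suc n)))"
          unfolding real_norm_def
          by (intro abs_diff_le f(2) linear_growth_call linear_growthI[OF bd])
      qed
    qed
    show "(LINT x|\<mu>. f x) = L f"
      using LIMSEQ_unique[OF lim_M lim_L] by (simp add: \<mu>_def integral_distr[OF max0 fmeas])
  qed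
qed

end

subsection \<open>Semicontinuous and convex functions\<close>

text \<open>Lipschitz regularization by sup-convolution with the cone of slope \<open>C + n\<close>.
  The share \<open>C\<close> of the slope absorbs the growth of \<open>h\<close>, the share
  \<open>n\<close> forces near-maximizers towards \<open>x\<close>, where upper semicontinuity takes
  over.\<close>

lemma usc_on_continuous_majorants:
  fixes h :: "real \<Rightarrow> real"
  assumes usc: "usc_on {0..} h" and h: "linear_growth h"
  obtains C g where "\<And>n. continuous_on {0..} (g n)" "\<And>n x. x \<ge> 0 \<Longrightarrow> h x \<le> g n x"
    "\<And>n x. x \<ge> 0 \<Longrightarrow> \<bar>g n x\<bar> \<le> C * (1 + x)" "\<And>x. x \<ge> 0 \<Longrightarrow> (\<lambda>n. g n x) \<longlonglongrightarrow> h x"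
proof -
  obtain C where C: "C \<ge> 0" "\<And>x. x \<ge> 0 \<Longrightarrow> \<bar>h x\<bar> \<le> C * (1 + x)"
    using linear_growthE[OF h] by blast
  define r where "r n x y = h y - (C + real n) * \<bar>x - y\<bar>" for n :: nat and x y
  define g where "g n x = (SUP y\<in>{0..}. r n x y)" for n x
  have r_le: "r n x y \<le> C * (1 + x) - real n * \<bar>x - y\<bar>" if "x \<ge> 0" "y \<ge> 0" for n x y
  proof -
    have "h y \<le> C * (1 + x) + C * (y - x)"
      using C(2)[OF that(2)] by (simp add: algebra_simps)
    also have "\<dots> \<le> C * (1 + x) + C * \<bar>x - y\<bar>"
      using C(1) by (intro add_left_mono mult_left_mono) auto
    finally show ?thesis by (simp add: r_def algebra_simps)
  qed
  have r_le': "r n x y \<le> C * (1 + x)" if "x \<ge> 0" "y \<ge> 0" for n x y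
  proof -
    have "0 \<le> real n * \<bar>x - y\<bar>" by simp
    then show ?thesis using r_le[OF that, of n] by linarith
  qed
  have bdd: "bdd_above (r n x ` {0..})" if "x \<ge> 0" for n x
  proof (rule bdd_aboveI2)
    fix y :: real assume "y \<in> {0..}"
    then show "r n x y \<le> C * (1 + x)"
      by (simp add: r_le' that)
  qed
  have g_ge: "r n x y \<le> g n x" if "x \<ge> 0" "y \<ge> 0" for n x y
    unfolding g_def using that by (intro cSUP_upper bdd) auto
  have g_le: "g n x \<le> m" if "\<And>y. y \<ge> 0 \<Longrightarrow> r n x y \<le> m" for n x m
    unfolding g_def using that by (intro cSUP_least) auto
  have h_le: "h x \<le> g n x" if "x \<ge> 0" for n x
    using g_ge[OF that that, of n] by (simp add: r_def)
  show thesis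
  proof
    show "h x \<le> g n x" if "x \<ge> 0" for n x
      by (rule h_le[OF that])
    show "\<bar>g n x\<bar> \<le> C * (1 + x)" if x: "x \<ge> 0" for n x
    proof -
      have "g n x \<le> C * (1 + x)"
        by (rule g_le) (rule r_le'[OF x])
      then show ?thesis using h_le[OF x, of n] C(2)[OF x] by (simp add: abs_le_iff)
    qed
    show "continuous_on {0..} (g n)" for n
    proof (rule lipschitz_on_continuous_on, rule lipschitz_onI)
      \<comment> \<open>A supremum of functions of \<open>x\<close> with Lipschitz constant
        \<open>C + n\<close> inherits this constant.\<close>
      have *: "g n x \<le> g n y + (C + real n) * \<bar>x - y\<bar>" if "x \<ge> 0" "y \<ge> 0" for x y
      proof (rule g_le)
        fix z :: real assume z: "z \<ge> 0"
        have "(C + real n) * \<bar>y - z\<bar> \<le> (C + real n) * (\<bar>x - z\<bar> + \<bar>x - y\<bar>)"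
          using C(1) by (intro mult_left_mono) auto
        then show "r n x z \<le> g n y + (C + real n) * \<bar>x - y\<bar>"
          using g_ge[OF that(2) z, of n] by (simp add: r_def algebra_simps)
      qed
      show "dist (g n x) (g n y) \<le> (C + real n) * dist x y" if "x \<in> {0..}" "y \<in> {0..}" for x y
        using *[of x y] *[of y x] that by (auto simp: dist_real_def abs_le_iff abs_minus_commute)
    qed (use C(1) in simp)
    show "(\<lambda>n. g n x) \<longlonglongrightarrow> h x" if x: "x \<ge> 0" for x
    proof (rule order_tendstoI)
      fix l assume "l < h x"
      then have "l < g n x" for n
        using h_le[OF x, of n] by linarith
      then show "\<forall>\<^sub>F n in sequentially. l < g n x" by simp
    next
      fix u assume "h x < u"
      then obtain c where c: "h x < c" "c < u" using dense by blast
      have "\<forall>\<^sub>F y in at x within {0..}. h y < c"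
        using usc x c(1) by (auto simp: usc_on_def)
      then obtain d where d: "d > 0" "\<And>y. y \<ge> 0 \<Longrightarrow> y \<noteq> x \<Longrightarrow> \<bar>y - x\<bar> < d \<Longrightarrow> h y < c"
        by (auto simp: eventually_at dist_real_def)
      \<comment> \<open>From \<open>N\<close> on, the penalty at distance at least \<open>d\<close>
        pushes \<open>C (1 + x)\<close> below \<open>c\<close>. Closer points satisfy
        \<open>h y < c\<close>, with \<open>y = x\<close> treated apart because the filter omits
        it.\<close>
      obtain N :: nat where N: "(C * (1 + x) - c) / d < real N"
        using reals_Archimedean2 by blast
      have "g n x \<le> c" if n: "n \<ge> N" for n
      proof (rule g_le)
        fix y :: real assume y: "y \<ge> 0"
        show "r n x y \<le> c"
        proof (cases "\<bar>y - x\<bar> < d")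
          case True
          then have "h y < c" using d(2)[OF y] c(1) by (cases "y = x") auto
          moreover have "(C + real n) * \<bar>x - y\<bar> \<ge> 0" using C(1) by simp
          ultimately show ?thesis by (simp add: r_def)
        next
          case False
          have "C * (1 + x) - c \<le> real N * d"
            using N d(1) by (simp add: field_simps)
          also have "\<dots> \<le> real n * \<bar>x - y\<bar>"
            using False n d(1) by (intro mult_mono) auto
          finally show ?thesis using r_le[OF x y, of n] by simp
        qed
      qed
      then show "\<forall>\<^sub>F n in sequentially. g n x < u"
        using c(2) eventually_ge_at_top[of N] by (fastforce elim!: eventually_mono)
    qed
  qed
qed

text \<open>A pointwise limit of the continuous majorants.\<close>

lemma borel_measurable_usc_on:
  fixes h :: "real \<Rightarrow> real"
  assumes "usc_on {0..} h" "linear_growth h"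
  shows "h \<in> borel_measurable (restrict_space borel {0..})"
proof -
  obtain C g where g: "\<And>n. continuous_on {0..} (g n)" "\<And>n x. x \<ge> 0 \<Longrightarrow> h x \<le> g n x"
    "\<And>n x. x \<ge> 0 \<Longrightarrow> \<bar>g n x\<bar> \<le> C * (1 + x)" "\<And>x. x \<ge> 0 \<Longrightarrow> (\<lambda>n. g n x) \<longlonglongrightarrow> h x"
    by (rule usc_on_continuous_majorants[OF assms]) (rule that)
  show ?thesis
    by (rule borel_measurable_LIMSEQ_real[where u = g])
      (auto simp: space_restrict_space intro!: g(1,4) borel_measurable_continuous_on_restrict)
qed

lemma integrable_usc_on: "\<mu> \<in> P1 \<Longrightarrow> usc_on {0..} h \<Longrightarrow> linear_growth h \<Longrightarrow> integrable \<mu> h"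
  by (rule integrable_P1[OF _ borel_measurable_usc_on])

section \<open>The cone of convex functions of linear growth\<close>

lemma CVX_L_add: "f \<in> CVX_L \<Longrightarrow> g \<in> CVX_L \<Longrightarrow> (\<lambda>x. f x + g x) \<in> CVX_L"
  by (auto simp: CVX_L_def intro: continuous_on_add convex_on_add linear_growth_add)

lemma CVX_L_cmult: "c \<ge> 0 \<Longrightarrow> f \<in> CVX_L \<Longrightarrow> (\<lambda>x. c * f x) \<in> CVX_L"
  by (auto simp: CVX_L_def intro: continuous_on_mult_left convex_on_cmul linear_growth_cmult)

lemma CVX_L_affine: "(\<lambda>x. a + c * x) \<in> CVX_L"
proof -
  have "convex_on {0..} (\<lambda>x::real. a + c * x)"
  proof (rule convex_onI)
    fix t x y :: real
    show "a + c * ((1 - t) *\<^sub>R x + t *\<^sub>R y) \<le> (1 - t) * (a + c * x) + t * (a + c * y)"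
      by (simp add: algebra_simps)
  qed simp
  then show ?thesis
    by (auto simp: CVX_L_def intro!: continuous_intros linear_growth_add linear_growth_const
        linear_growth_cmult linear_growth_ident)
qed

lemma CVX_L_const: "(\<lambda>x. c) \<in> CVX_L"
  using CVX_L_affine[of c 0] by simp

lemma CVX_L_call: "(\<lambda>x. max 0 (x - k)) \<in> CVX_L"
proof -
  have "convex_on {0..} (\<lambda>x::real. max 0 (x - k))"
  proof (rule convex_onI)
    fix t x y :: real assume t: "0 < t" "t < 1"
    have "(1 - t) * (x - k) + t * (y - k) \<le> (1 - t) * max 0 (x - k) + t * max 0 (y - k)"
      using t by (intro add_mono mult_left_mono) auto
    moreover have "0 \<le> (1 - t) * max 0 (x - k) + t * max 0 (y - k)"
      using t by simp
    moreover have "(1 - t) *\<^sub>R x + t *\<^sub>R y - k = (1 - t) * (x - k) + t * (y - k)"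
      by (simp add: algebra_simps)
    ultimately show "max 0 ((1 - t) *\<^sub>R x + t *\<^sub>R y - k) \<le> (1 - t) * max 0 (x - k) + t * max 0 (y - k)"
      by (simp only: max.bounded_iff)
  qed simp
  then show ?thesis
    by (auto simp: CVX_L_def intro!: continuous_intros linear_growth_call)
qed

lemma CVX_L_linear_growth: "f \<in> CVX_L \<Longrightarrow> linear_growth f"
  and CVX_L_continuous: "f \<in> CVX_L \<Longrightarrow> continuous_on {0..} f"
  by (auto simp: CVX_L_def)

lemma integrable_CVX_L: "\<mu> \<in> P1 \<Longrightarrow> f \<in> CVX_L \<Longrightarrow> integrable \<mu> f"
  by (intro integrable_P1_continuous) (auto simp: CVX_L_def)

text \<open>Source of \<open>tail\<close>: a functional below \<open>\<mu>a\<close> on calls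
  inherits this decay.\<close>

lemma integral_call_tendsto_0:
  assumes "\<mu> \<in> P1"
  shows "(\<lambda>n. LINT x|\<mu>. max 0 (x - real n)) \<longlonglongrightarrow> 0"
proof -
  have "(\<lambda>n. LINT x|\<mu>. max 0 (x - real n)) \<longlonglongrightarrow> (LINT x|\<mu>. 0)"
  proof (rule integral_dominated_convergence[where w = "\<lambda>x. x"])
    show "integrable \<mu> (\<lambda>x. x)" using assms by (simp add: P1_def)
    show "(\<lambda>x. max 0 (x - real n)) \<in> borel_measurable \<mu>" for n
      using integrable_CVX_L[OF assms CVX_L_call] by (rule borel_measurable_integrable)
    show "AE x in \<mu>. (\<lambda>n. max 0 (x - real n)) \<longlonglongrightarrow> 0"
    proof (intro AE_I2 tendsto_eventually)
      fix x :: real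
      obtain n :: nat where "x < real n" using reals_Archimedean2 by blast
      then show "\<forall>\<^sub>F n in sequentially. max 0 (x - real n) = 0"
        by (auto simp: eventually_sequentially intro!: exI[of _ n])
    qed
    show "AE x in \<mu>. norm (max 0 (x - real n)) \<le> x" for n
      by (intro AE_I2) (auto simp: space_P1[OF assms])
  qed auto
  then show ?thesis by simp
qed

lemma PsiI: "a \<in> CVX_L \<Longrightarrow> b \<in> CVX_L \<Longrightarrow> (\<And>x. x \<ge> 0 \<Longrightarrow> h x \<le> a x - b x) \<Longrightarrow> (a, b) \<in> Psi h"
  and PsiD: "(a, b) \<in> Psi h \<Longrightarrow> a \<in> CVX_L" "(a, b) \<in> Psi h \<Longrightarrow> b \<in> CVX_L"
    "(a, b) \<in> Psi h \<Longrightarrow> x \<ge> 0 \<Longrightarrow> h x \<le> a x - b x"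
  by (auto simp: Psi_def)

subsection \<open>The dual problem\<close>

locale cx_ordered_pair =
  fixes \<mu>b \<mu>a :: "real measure"
  assumes b_P1: "\<mu>b \<in> P1" and a_P1: "\<mu>a \<in> P1" and ordered: "\<mu>b \<preceq>\<^sub>c\<^sub>x \<mu>a"
begin

definition "cost \<psi> = (LINT x|\<mu>a. fst \<psi> x) - (LINT x|\<mu>b. snd \<psi> x)"

text \<open>The infimum is real-valued; \<open>Psi_nonempty\<close> and
  \<open>bdd_below_cost\<close> make it meaningful for every \<open>f\<close> of linear
  growth.\<close>

definition "dual_value f = (INF \<psi>\<in>Psi f. cost \<psi>)"

text \<open>Weak duality: the pointwise inequality is integrated against \<open>\<mu>\<close>, then
  each half of the pair is moved to its marginal by the convex order.\<close>

lemma integral_le_cost: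
  assumes \<mu>: "\<mu> \<in> Q \<mu>b \<mu>a" and h: "integrable \<mu> h" and \<psi>: "\<psi> \<in> Psi h"
  shows "(LINT x|\<mu>. h x) \<le> cost \<psi>"
proof -
  obtain a b where ab: "\<psi> = (a, b)" by fastforce
  note D = PsiD[OF \<psi>[unfolded ab]]
  have P1: "\<mu> \<in> P1" using \<mu> by (simp add: Q_def)
  note ints = integrable_CVX_L[OF P1 D(1)] integrable_CVX_L[OF P1 D(2)]
  have "(LINT x|\<mu>. h x) \<le> (LINT x|\<mu>. a x - b x)"
    using h ints by (intro integral_mono) (auto simp: space_P1[OF P1] D(3))
  also have "\<dots> = (LINT x|\<mu>. a x) - (LINT x|\<mu>. b x)"
    using ints by simp
  also have "\<dots> \<le> cost \<psi>"
    using \<mu> D(1,2) by (auto simp: Q_def cx_le_def cost_def ab intro!: diff_mono)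
  finally show ?thesis .
qed

lemma a_in_Q: "\<mu>a \<in> Q \<mu>b \<mu>a"
  using a_P1 ordered by (auto simp: Q_def cx_le_def)

lemma Psi_nonempty:
  assumes "linear_growth f"
  shows "Psi f \<noteq> {}"
proof -
  obtain C where C: "\<And>x. x \<ge> 0 \<Longrightarrow> \<bar>f x\<bar> \<le> C * (1 + x)"
    using linear_growthE[OF assms] by blast
  have "((\<lambda>x. C + C * x), (\<lambda>x. 0)) \<in> Psi f"
    using C by (intro PsiI CVX_L_affine CVX_L_const) (fastforce simp: algebra_simps abs_le_iff)
  then show ?thesis by blast
qed

text \<open>Since \<open>f\<close> may fail to be measurable, weak duality is applied to its affine
  minorant \<open>- C - C x\<close>: pairs admissible for \<open>f\<close> are admissible for
  it.\<close>

lemma bdd_below_cost: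
  assumes "linear_growth f"
  shows "bdd_below (cost ` Psi f)"
proof -
  obtain C where C: "\<And>x. x \<ge> 0 \<Longrightarrow> \<bar>f x\<bar> \<le> C * (1 + x)"
    using linear_growthE[OF assms] by blast
  have "Psi f \<subseteq> Psi (\<lambda>x. - C + (- C) * x)"
  proof
    fix \<psi> assume \<psi>: "\<psi> \<in> Psi f"
    obtain a b where ab: "\<psi> = (a, b)" by fastforce
    note D = PsiD[OF \<psi>[unfolded ab]]
    show "\<psi> \<in> Psi (\<lambda>x. - C + (- C) * x)"
      unfolding ab
    proof (rule PsiI[OF D(1,2)])
      fix x :: real assume "x \<ge> 0"
      then show "- C + (- C) * x \<le> a x - b x"
        using C[of x] D(3)[of x] by (simp add: algebra_simps abs_le_iff)
    qed
  qed
  then show ?thesis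
    by (intro bdd_belowI2[where m = "LINT x|\<mu>a. - C + (- C) * x"] integral_le_cost a_in_Q
        integrable_CVX_L a_P1 CVX_L_affine) auto
qed

lemma dual_value_le: "linear_growth f \<Longrightarrow> \<psi> \<in> Psi f \<Longrightarrow> dual_value f \<le> cost \<psi>"
  unfolding dual_value_def by (intro cINF_lower bdd_below_cost)

lemma dual_value_ge: "linear_growth f \<Longrightarrow> (\<And>\<psi>. \<psi> \<in> Psi f \<Longrightarrow> m \<le> cost \<psi>) \<Longrightarrow> m \<le> dual_value f"
  unfolding dual_value_def by (intro cINF_greatest Psi_nonempty)

text \<open>Admissible pairs can be added and scaled by positive factors, and \<open>cost\<close>
  follows linearly.\<close>

lemma sublinear_dual_value: "sublinear_on {f. linear_growth f} dual_value"
  unfolding sublinear_on_def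
proof (intro conjI ballI allI impI; unfold mem_Collect_eq)
  fix f g assume f: "linear_growth f" and g: "linear_growth g"
  have key: "dual_value (\<lambda>x. f x + g x) \<le> cost \<psi> + cost \<phi>" if \<psi>: "\<psi> \<in> Psi f" and \<phi>: "\<phi> \<in> Psi g" for \<psi> \<phi>
  proof -
    obtain a b c d where ab: "\<psi> = (a, b)" "\<phi> = (c, d)" by fastforce
    note D = PsiD[OF \<psi>[unfolded ab]] PsiD[OF \<phi>[unfolded ab]]
    have "((\<lambda>x. a x + c x), (\<lambda>x. b x + d x)) \<in> Psi (\<lambda>x. f x + g x)"
      using D(3,6) by (intro PsiI CVX_L_add D) (smt (verit))
    then have "dual_value (\<lambda>x. f x + g x) \<le> cost ((\<lambda>x. a x + c x), (\<lambda>x. b x + d x))"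
      by (rule dual_value_le[OF linear_growth_add[OF f g]])
    also have "\<dots> = cost \<psi> + cost \<phi>"
      using D by (simp add: cost_def ab integrable_CVX_L a_P1 b_P1)
    finally show ?thesis .
  qed
  have "dual_value (\<lambda>x. f x + g x) - cost \<psi> \<le> dual_value g" if "\<psi> \<in> Psi f" for \<psi>
    by (rule dual_value_ge[OF g]) (use key[OF that] in \<open>simp add: algebra_simps\<close>)
  then have "dual_value (\<lambda>x. f x + g x) - dual_value g \<le> dual_value f"
    by (intro dual_value_ge[OF f]) (simp add: algebra_simps)
  then show "dual_value (\<lambda>x. f x + g x) \<le> dual_value f + dual_value g" by simp
next
  fix f and c :: real assume f: "linear_growth f" and c: "0 < c"
  have "dual_value (\<lambda>x. c * f x) / c \<le> cost \<psi>" if \<psi>: "\<psi> \<in> Psi f" for \<psi>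
  proof -
    obtain a b where ab: "\<psi> = (a, b)" by fastforce
    note D = PsiD[OF \<psi>[unfolded ab]]
    have "c * f x \<le> c * a x - c * b x" if "x \<ge> 0" for x
      using mult_left_mono[OF D(3)[OF that], of c] c by (simp add: algebra_simps)
    then have "((\<lambda>x. c * a x), (\<lambda>x. c * b x)) \<in> Psi (\<lambda>x. c * f x)"
      using c by (intro PsiI CVX_L_cmult D) auto
    then have "dual_value (\<lambda>x. c * f x) \<le> cost ((\<lambda>x. c * a x), (\<lambda>x. c * b x))"
      by (rule dual_value_le[OF linear_growth_cmult[OF f]])
    also have "\<dots> = c * cost \<psi>"
      by (simp add: cost_def ab algebra_simps)
    finally show ?thesis using c by (simp add: field_simps)
  qed
  then have "dual_value (\<lambda>x. c * f x) / c \<le> dual_value f" by (rule dual_value_ge[OF f])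
  then show "dual_value (\<lambda>x. c * f x) \<le> c * dual_value f" using c by (simp add: field_simps)
qed

lemma dual_value_nonpos: "linear_growth f \<Longrightarrow> (\<And>x. x \<ge> 0 \<Longrightarrow> f x \<le> 0) \<Longrightarrow> dual_value f \<le> 0"
  using dual_value_le[of f "((\<lambda>x. 0), (\<lambda>x. 0))"] PsiI[OF CVX_L_const CVX_L_const, of f 0 0]
  by (simp add: cost_def)

text \<open>The pairs \<open>(\<psi>, 0)\<close> and \<open>(0, \<psi>)\<close> are admissible. For
  a linear functional below \<open>dual_value\<close> this yields the two convex order
  relations.\<close>

lemma dual_value_CVX_L: "\<psi> \<in> CVX_L \<Longrightarrow> dual_value \<psi> \<le> (LINT x|\<mu>a. \<psi> x)"
    and dual_value_uminus_CVX_L: "\<psi> \<in> CVX_L \<Longrightarrow> dual_value (\<lambda>x. - \<psi> x) \<le> - (LINT x|\<mu>b. \<psi> x)"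
  using dual_value_le[of \<psi> "(\<psi>, (\<lambda>x. 0))"] PsiI[OF _ CVX_L_const, of \<psi> \<psi> 0]
    dual_value_le[of "\<lambda>x. - \<psi> x" "((\<lambda>x. 0), \<psi>)"] PsiI[OF CVX_L_const, of \<psi> "\<lambda>x. - \<psi> x" 0]
  by (auto simp: cost_def CVX_L_linear_growth linear_growth_uminus)

lemma maximizer_exists:
  assumes usc: "usc_on {0..} h" and h: "linear_growth h"
  obtains \<mu> where "\<mu> \<in> Q \<mu>b \<mu>a" "dual_value h \<le> (LINT x|\<mu>. h x)"
proof -
  note lin_space = fun_subspace_linear_growth
  obtain L where lin: "linear_on_funs {f. linear_growth f} L"
    and Lp: "\<And>f. linear_growth f \<Longrightarrow> L f \<le> dual_value f" and Lh: "L h = dual_value h"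
    by (rule hahn_banach_sublinear_on[OF lin_space sublinear_dual_value, of h, unfolded mem_Collect_eq, OF h])
      (rule that)
  have L_a: "L \<psi> \<le> (LINT x|\<mu>a. \<psi> x)" if "\<psi> \<in> CVX_L" for \<psi>
    using Lp[OF CVX_L_linear_growth[OF that]] dual_value_CVX_L[OF that] by linarith
  have L_b: "(LINT x|\<mu>b. \<psi> x) \<le> L \<psi>" if "\<psi> \<in> CVX_L" for \<psi>
    using Lp[OF linear_growth_uminus[OF CVX_L_linear_growth[OF that]]] dual_value_uminus_CVX_L[OF that]
      linear_on_funs_uminus[OF lin, of \<psi>] CVX_L_linear_growth[OF that] by simp
  interpret a: prob_space \<mu>a using a_P1 by (simp add: P1_def)
  interpret b: prob_space \<mu>b using b_P1 by (simp add: P1_def)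
  interpret tight_mean L
  proof
    show "L f \<le> L g" if "linear_growth f" "linear_growth g" "\<And>x. x \<ge> 0 \<Longrightarrow> f x \<le> g x" for f g
    proof -
      have "L (\<lambda>x. f x - g x) \<le> 0"
        using Lp[of "\<lambda>x. f x - g x"] dual_value_nonpos[of "\<lambda>x. f x - g x"] that
        by (simp add: linear_growth_diff order_trans)
      then show ?thesis
        using linear_on_funs_diff[OF lin_space lin] that by simp
    qed
    \<comment> \<open>The bounds from \<open>\<mu>a\<close> and \<open>\<mu>b\<close> coincide on
      constants, both being probability measures.\<close>
    show "L (\<lambda>x. 1) = 1"
      using L_a[OF CVX_L_const, of 1] L_b[OF CVX_L_const, of 1]
      by (simp add: a.prob_space b.prob_space)
    \<comment> \<open>Calls are convex, so \<open>L\<close> is squeezed between a nonnegative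
      \<open>\<mu>b\<close> integral and the vanishing \<open>\<mu>a\<close> integral.\<close>
    show "(\<lambda>n. L (\<lambda>x. max 0 (x - real n))) \<longlonglongrightarrow> 0"
    proof (rule tendsto_sandwich[OF _ _ tendsto_const integral_call_tendsto_0[OF a_P1]])
      have "0 \<le> (LINT x|\<mu>b. max 0 (x - real n))" for n
        by (rule Bochner_Integration.integral_nonneg) simp
      then show "\<forall>\<^sub>F n in sequentially. 0 \<le> L (\<lambda>x. max 0 (x - real n))"
        by (intro always_eventually allI order_trans[OF _ L_b[OF CVX_L_call]])
    qed (intro always_eventually allI L_a CVX_L_call)
  qed (rule lin)
  obtain \<mu> where \<mu>: "\<mu> \<in> P1"
    and rep: "\<And>f. continuous_on {0..} f \<Longrightarrow> linear_growth f \<Longrightarrow> (LINT x|\<mu>. f x) = L f"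
    using representation by blast
  show thesis
  proof
    show "\<mu> \<in> Q \<mu>b \<mu>a"
      using \<mu> L_a L_b by (simp add: Q_def cx_le_def rep CVX_L_linear_growth CVX_L_continuous)
    obtain C g where g: "\<And>n. continuous_on {0..} (g n)" "\<And>n x. x \<ge> 0 \<Longrightarrow> h x \<le> g n x"
      "\<And>n x. x \<ge> 0 \<Longrightarrow> \<bar>g n x\<bar> \<le> C * (1 + x)" "\<And>x. x \<ge> 0 \<Longrightarrow> (\<lambda>n. g n x) \<longlonglongrightarrow> h x"
      by (rule usc_on_continuous_majorants[OF usc h]) (rule that)
    have g_lg: "linear_growth (g n)" for n
      by (rule linear_growthI[OF g(3)])
    have "(\<lambda>n. LINT x|\<mu>. g n x) \<longlonglongrightarrow> (LINT x|\<mu>. h x)"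
    proof (rule integral_dominated_convergence[where w = "\<lambda>x. C + C * x"])
      show "integrable \<mu> (\<lambda>x. C + C * x)"
        by (rule integrable_CVX_L[OF \<mu> CVX_L_affine])
      show "h \<in> borel_measurable \<mu>"
        using integrable_usc_on[OF \<mu> usc h] by (rule borel_measurable_integrable)
      show "g n \<in> borel_measurable \<mu>" for n
        using integrable_P1_continuous[OF \<mu> g(1) g_lg] by (rule borel_measurable_integrable)
      show "AE x in \<mu>. (\<lambda>n. g n x) \<longlonglongrightarrow> h x"
        by (intro AE_I2 g(4)) (simp add: space_P1[OF \<mu>])
      show "AE x in \<mu>. norm (g n x) \<le> C + C * x" for n
        using g(3) by (intro AE_I2) (simp add: space_P1[OF \<mu>] algebra_simps)
    qed
    \<comment> \<open>Only monotonicity of \<open>L\<close> is used at \<open>h\<close>: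
      \<open>dual_value h = L h \<le> L (g n)\<close>, and \<open>L (g n)\<close> is an integral
      since \<open>g n\<close> is continuous. The passage to the limit takes place under
      \<open>\<mu>\<close>.\<close>
    moreover have "dual_value h \<le> (LINT x|\<mu>. g n x)" for n
      unfolding rep[OF g(1) g_lg] Lh[symmetric] by (intro mono h g_lg g(2))
    ultimately show "dual_value h \<le> (LINT x|\<mu>. h x)"
      using LIMSEQ_le_const by blast
  qed
qed

end

theorem theorem3p2:
  fixes \<mu>b \<mu>a :: "real measure" and h :: "real \<Rightarrow> real"
  assumes "\<mu>b \<in> P1" and "\<mu>a \<in> P1" and "\<mu>b \<preceq>\<^sub>c\<^sub>x \<mu>a"
    and "usc_on {0..} h" and "linear_growth h"
  shows "(SUP \<mu>\<in>Q \<mu>b \<mu>a. ereal (LINT x|\<mu>. h x)) =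
      (INF (\<psi>a, \<psi>b)\<in>Psi h. ereal ((LINT x|\<mu>a. \<psi>a x) - (LINT x|\<mu>b. \<psi>b x)))
    \<and> (\<exists>\<mu>'\<in>Q \<mu>b \<mu>a. ereal (LINT x|\<mu>'. h x) = (SUP \<mu>\<in>Q \<mu>b \<mu>a. ereal (LINT x|\<mu>. h x)))"
proof -
  interpret cx_ordered_pair \<mu>b \<mu>a
    by unfold_locales (fact assms)+
  define S where "S = (SUP \<mu>\<in>Q \<mu>b \<mu>a. ereal (LINT x|\<mu>. h x))"
  define I where "I = (INF (\<psi>a, \<psi>b)\<in>Psi h. ereal ((LINT x|\<mu>a. \<psi>a x) - (LINT x|\<mu>b. \<psi>b x)))"
  have I: "I = (INF \<psi>\<in>Psi h. ereal (cost \<psi>))"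
    unfolding I_def cost_def by (simp add: case_prod_beta)
  obtain \<mu> where \<mu>: "\<mu> \<in> Q \<mu>b \<mu>a" "dual_value h \<le> (LINT x|\<mu>. h x)"
    by (rule maximizer_exists[OF assms(4,5)]) (rule that)
  have SI: "S \<le> I"
    unfolding S_def I
    by (intro SUP_least INF_greatest)
      (auto simp: Q_def intro!: integral_le_cost integrable_usc_on assms)
  \<comment> \<open>The real infimum is carried over to the extended reals by pairs whose cost is
    within \<open>e\<close> of it.\<close>
  have Ip: "I \<le> ereal (dual_value h)"
  proof (rule ereal_le_epsilon2)
    fix e :: real assume "e > 0"
    then obtain \<psi> where "\<psi> \<in> Psi h" "cost \<psi> < dual_value h + e"
      using dual_value_ge[OF assms(5), of "dual_value h + e"] by force
    then show "I \<le> ereal (dual_value h) + ereal e"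
      unfolding I by (intro INF_lower2[of \<psi>]) auto
  qed
  \<comment> \<open>The cycle \<open>S \<le> I \<le> \<mu>(h) \<le> S\<close> closes, giving both
    equality and attainment.\<close>
  have "I \<le> ereal (LINT x|\<mu>. h x)"
    using Ip \<mu>(2) by (rule order_trans[OF _ iffD2[OF ereal_less_eq(3)]])
  moreover have "ereal (LINT x|\<mu>. h x) \<le> S"
    unfolding S_def using \<mu>(1) by (rule SUP_upper)
  ultimately have "S = I" "ereal (LINT x|\<mu>. h x) = S"
    using SI by (metis antisym order_trans)+
  then show ?thesis using \<mu>(1) unfolding S_def I_def by blast
qed

end
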